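(* For any $\epsilon\in(0,0.9)$, any one-pass $(1+\epsilon,0.49)$-$L_{\mathrm{DI}}$-sampler (in the node-arrival streaming model) on a data stream of length $n$ needs $\Omega(n)$ bits of space.
   Context: Similarity graph. $U$ is a universe of items and $f:U\times U\to[0,1]$ is a symmetric similarity function with $f(x,x)=1$ for all $x\in U$. For a stream $\sigma=(\sigma_1,\dots,\sigma_n)\in U^n$, the degree of node $i\in[n]$ in the similarity graph $G^\sigma$ (complete graph on $[n]$ with self-loops, weights $w(i,j)=f(\sigma_i,\sigma_j)$) is $d_i=\sum_{j\in[n]} f(\sigma_i,\sigma_j)$, and $\mathrm{DI}(\sigma)=\sum_{i\in[n]} d_i^{-1}$. Each stream position is a distinct node; node $i$ is represented by the pair $(i,\sigma_i)$. Sampler. A $(1+\epsilon,\delta)$-$L_{\mathrm{DI}}$-sampler on $G^\sigma$ fails with probability at most $\delta$ and, conditioned on no failure, outputs node $i$ with a probability $p_i$ satisfying $(1-\epsilon)\frac{d_i^{-1}}{\mathrm{DI}(\sigma)}\le p_i\le(1+\epsilon)\frac{d_i^{-1}}{\mathrm{DI}(\sigma)}$, for every $i\in[n]$. Node-arrival streaming model. The items $\sigma_1,\dots,\sigma_n$ arrive sequentially and the algorithm, which has access to $f$, makes one or more linear scans (passes) over them while maintaining a bounded memory state. Algorithms are randomized; the algorithm's guarantee is required for every universe $U$, every similarity function $f$ and every stream $\sigma$ of length $n$, and its space is the worst-case number of bits of memory. *)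

theory Defs
  imports "HOL-Probability.Probability" "HOL-Library.Infinite_Typeclass"
begin

section \<open>Similarity graphs of streams\<close>

definition similarity :: "'u set \<Rightarrow> ('u \<Rightarrow> 'u \<Rightarrow> real) \<Rightarrow> bool" where
  "similarity U f \<longleftrightarrow>
     (\<forall>x\<in>U. \<forall>y\<in>U. 0 \<le> f x y \<and> f x y \<le> 1 \<and> f x y = f y x) \<and> (\<forall>x\<in>U. f x x = 1)"

definition degree :: "('u \<Rightarrow> 'u \<Rightarrow> real) \<Rightarrow> 'u list \<Rightarrow> nat \<Rightarrow> real" where
  "degree f \<sigma> i = (\<Sum>j<length \<sigma>. f (\<sigma> ! i) (\<sigma> ! j))"

definition DI :: "('u \<Rightarrow> 'u \<Rightarrow> real) \<Rightarrow> 'u list \<Rightarrow> real" where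
  "DI f \<sigma> = (\<Sum>i<length \<sigma>. 1 / degree f \<sigma> i)"

text \<open>Positions are numbered from 0; the node at position \<open>i\<close> is the pair \<open>(i, \<sigma> ! i)\<close>.\<close>

definition nodes :: "'u list \<Rightarrow> (nat \<times> 'u) list" where
  "nodes \<sigma> = List.enumerate 0 \<sigma>"

section \<open>Samplers\<close>

text \<open>\<open>D\<close> is the output distribution on stream \<open>\<sigma>\<close>; the outcome \<open>None\<close> is failure.\<close>

definition L_DI_sample ::
  "real \<Rightarrow> real \<Rightarrow> ('u \<Rightarrow> 'u \<Rightarrow> real) \<Rightarrow> 'u list \<Rightarrow> (nat \<times> 'u) option pmf \<Rightarrow> bool" where
  "L_DI_sample \<epsilon> \<delta> f \<sigma> D \<longleftrightarrow>
     \<P>(r in measure_pmf D. r = None) \<le> \<delta> \<and>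
     (\<forall>i<length \<sigma>.
        let p = \<P>(r in measure_pmf D. r = Some (i, \<sigma> ! i) \<bar> r \<noteq> None);
            q = (1 / degree f \<sigma> i) / DI f \<sigma>
        in (1 - \<epsilon>) * q \<le> p \<and> p \<le> (1 + \<epsilon>) * q)"

section \<open>One-pass streaming algorithms\<close>

type_synonym memory = "bool list"

text \<open>The memory content is all that is carried from one arriving node to the next.
  The kernels \<open>start\<close>, \<open>update\<close> and \<open>answer\<close> may toss fresh coins.\<close>

record 'u machine =
  start :: "memory pmf"
  update :: "nat \<times> 'u \<Rightarrow> memory \<Rightarrow> memory pmf"
  answer :: "memory \<Rightarrow> (nat \<times> 'u) option pmf"

text \<open>An algorithm has access to the universe and the similarity function. Drawing the machine
  from a distribution models a random string that can be reread without being stored; its bits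
  are not counted as space.\<close>

type_synonym 'u algorithm = "'u set \<Rightarrow> ('u \<Rightarrow> 'u \<Rightarrow> real) \<Rightarrow> 'u machine pmf"

definition memory_after :: "'u machine \<Rightarrow> (nat \<times> 'u) list \<Rightarrow> memory pmf" where
  "memory_after M vs = fold (\<lambda>v D. bind_pmf D (update M v)) vs (start M)"

definition result ::
  "'u algorithm \<Rightarrow> 'u set \<Rightarrow> ('u \<Rightarrow> 'u \<Rightarrow> real) \<Rightarrow> 'u list \<Rightarrow> (nat \<times> 'u) option pmf" where
  "result A U f \<sigma> =
     bind_pmf (A U f) (\<lambda>M. bind_pmf (memory_after M (nodes \<sigma>)) (answer M))"

text \<open>Universes are finite: with bounded memory, an unbounded supply of items cannot be
  distinguished, and over an uncountable universe no machine could report the sampled item.\<close>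

definition one_pass_L_DI_sampler :: "nat \<Rightarrow> real \<Rightarrow> real \<Rightarrow> 'u algorithm \<Rightarrow> bool" where
  "one_pass_L_DI_sampler n \<epsilon> \<delta> A \<longleftrightarrow>
     (\<forall>U f \<sigma>. finite U \<and> similarity U f \<and> set \<sigma> \<subseteq> U \<and> length \<sigma> = n \<longrightarrow>
        L_DI_sample \<epsilon> \<delta> f \<sigma> (result A U f \<sigma>))"

text \<open>At most \<open>s\<close> bits of memory in the worst case, over all similarity functions on universes of
  at most \<open>k\<close> items, all streams of length \<open>n\<close>, all coin tosses and all times. Some restriction on
  the size of the universe is needed: without it the space of every sampler is unbounded, merely
  because the reported pair \<open>(i, \<sigma> ! i)\<close> contains an item of the universe.\<close>

definition space_at_most :: "nat \<Rightarrow> nat \<Rightarrow> 'u algorithm \<Rightarrow> nat \<Rightarrow> bool" where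
  "space_at_most n k A s \<longleftrightarrow>
     (\<forall>U f \<sigma>. finite U \<and> card U \<le> k \<and> similarity U f \<and> set \<sigma> \<subseteq> U \<and> length \<sigma> = n \<longrightarrow>
        (\<forall>M\<in>set_pmf (A U f). \<forall>t\<le>n. \<forall>m\<in>set_pmf (memory_after M (take t (nodes \<sigma>))).
           length m \<le> s))"

end

theory Submission
  imports Defs
begin

text \<open>Reduction from random access codes over an alphabet of constant size \<open>K\<close>. The first \<open>m\<close>
  items of the stream are pairwise dissimilar and spell out a word \<open>x\<close>. The remaining \<open>n - m\<close>
  items are copies of one item that is similar to all of the first \<open>m\<close> items except the one at
  a chosen position \<open>j\<close>. Then node \<open>j\<close> has degree 1 while every other node has degree at
  least \<open>n - m\<close>, so \<open>DI \<le> 3\<close> and the sampler reports \<open>(j, x j)\<close> with a probability bounded below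
  by a constant. Hence the memory after \<open>m\<close> steps allows any letter of \<open>x\<close> to be recovered with
  that probability. The sampler may also report wrong items, with total probability up to
  \<open>\<epsilon>\<close>, so \<open>K\<close> has to be large: guessing succeeds with probability \<open>1 / K\<close> only.\<close>

section \<open>Counting bound for random access codes with shared randomness\<close>

lemma exp_le_one_plus_twice:
  fixes x :: real
  assumes "0 \<le> x" "x \<le> 1"
  shows "exp x \<le> 1 + 2 * x"
proof -
  have "x\<^sup>2 \<le> x"
    using assms by (simp add: power2_eq_square mult_left_le)
  with exp_bound[OF assms] show ?thesis
    by linarith
qed

text \<open>The exponential factorises over the coordinates. At each one, linearising
  \<open>exp\<close> on [0,1] and using total mass at most 1 leaves a factor of at most
  \<open>card V + 2\<close>.\<close>

lemma sum_PiE_exp_le: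
  fixes D :: "'i \<Rightarrow> 'v \<Rightarrow> real"
  assumes "finite I" "finite V" "V \<noteq> {}"
    and D0: "\<And>i v. 0 \<le> D i v" and D1: "\<And>i. i \<in> I \<Longrightarrow> (\<Sum>v\<in>V. D i v) \<le> 1"
  shows "(\<Sum>x\<in>I \<rightarrow>\<^sub>E V. exp (\<Sum>i\<in>I. D i (x i)))
           \<le> real (card V) ^ card I * exp (2 * real (card I) / real (card V))"
proof -
  let ?K = "real (card V)"
  have K: "?K > 0"
    using assms by (simp add: card_gt_0_iff)
  have "(\<Sum>v\<in>V. exp (D i v)) \<le> ?K * exp (2 / ?K)" if i: "i \<in> I" for i
  proof -
    have "D i v \<le> 1" if "v \<in> V" for v
      using member_le_sum[of v V "D i"] that assms(2) D0 D1[OF i] by force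
    then have "(\<Sum>v\<in>V. exp (D i v)) \<le> (\<Sum>v\<in>V. 1 + 2 * D i v)"
      by (intro sum_mono exp_le_one_plus_twice D0)
    also have "\<dots> = ?K + 2 * (\<Sum>v\<in>V. D i v)"
      by (simp add: sum.distrib sum_distrib_left)
    also have "\<dots> \<le> ?K * (1 + 2 / ?K)"
      using D1[OF i] K by (simp add: field_simps)
    also have "\<dots> \<le> ?K * exp (2 / ?K)"
      using K by (intro mult_left_mono exp_ge_add_one_self) auto
    finally show ?thesis .
  qed
  then have "(\<Prod>i\<in>I. \<Sum>v\<in>V. exp (D i v)) \<le> (\<Prod>i\<in>I. ?K * exp (2 / ?K))"
    by (intro prod_mono) (auto intro: sum_nonneg)
  also have "\<dots> = ?K ^ card I * exp (2 * real (card I) / ?K)"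
    by (simp add: power_mult_distrib exp_of_nat_mult[symmetric] mult_ac)
  finally show ?thesis
    using assms by (simp add: exp_sum prod_sum_PiE)
qed

text \<open>The bound \<open>y \<le> t + exp (y - t)\<close> replaces the maximum over the code words \<open>c\<close> by a sum,
  whose average over \<open>x\<close> factorises over the coordinates.\<close>

lemma soft_decoding_bound:
  fixes D :: "'c \<Rightarrow> 'i \<Rightarrow> 'v \<Rightarrow> real"
  assumes "finite I" "finite V" "V \<noteq> {}" "finite C" "C \<noteq> {}"
    and D0: "\<And>c i v. 0 \<le> D c i v"
    and D1: "\<And>c i. c \<in> C \<Longrightarrow> i \<in> I \<Longrightarrow> (\<Sum>v\<in>V. D c i v) \<le> 1"
    and E: "\<And>x. x \<in> I \<rightarrow>\<^sub>E V \<Longrightarrow> set_pmf (E x) \<subseteq> C"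
  shows "(\<Sum>x\<in>I \<rightarrow>\<^sub>E V. \<Sum>c\<in>C. pmf (E x) c * (\<Sum>i\<in>I. D c i (x i)))
           \<le> real (card V) ^ card I * (ln (real (card C)) + 2 * real (card I) / real (card V) + 1)"
proof -
  let ?X = "I \<rightarrow>\<^sub>E V"
  let ?Y = "\<lambda>x c. \<Sum>i\<in>I. D c i (x i)"
  let ?B = "real (card V) ^ card I"
  \<comment> \<open>With this \<open>t\<close>, \<open>exp (- t)\<close> cancels both the number of
    code words and the factor from \<open>sum_PiE_exp_le\<close>; replacing the maximum by a sum
    then costs only the final 1.\<close>
  define t where "t = ln (real (card C)) + 2 * real (card I) / real (card V)"
  have cC: "real (card C) > 0"
    using assms by (simp add: card_gt_0_iff)
  have "(\<Sum>c\<in>C. pmf (E x) c * ?Y x c) \<le> t + (\<Sum>c\<in>C. exp (?Y x c - t))" if x: "x \<in> ?X" for x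
  proof -
    have "pmf (E x) c * ?Y x c \<le> pmf (E x) c * t + exp (?Y x c - t)" for c
    proof -
      have "?Y x c \<le> t + exp (?Y x c - t)"
        using exp_ge_add_one_self[of "?Y x c - t"] by linarith
      then have "pmf (E x) c * ?Y x c \<le> pmf (E x) c * (t + exp (?Y x c - t))"
        by (intro mult_left_mono) auto
      also have "\<dots> \<le> pmf (E x) c * t + exp (?Y x c - t)"
        using pmf_le_1[of "E x" c] by (simp add: distrib_left mult_left_le_one_le)
      finally show ?thesis .
    qed
    then have "(\<Sum>c\<in>C. pmf (E x) c * ?Y x c) \<le> (\<Sum>c\<in>C. pmf (E x) c * t + exp (?Y x c - t))"
      by (intro sum_mono)
    also have "\<dots> = t + (\<Sum>c\<in>C. exp (?Y x c - t))"
      using sum_pmf_eq_1[OF \<open>finite C\<close> E[OF x]]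
      by (simp add: sum.distrib sum_distrib_right[symmetric])
    finally show ?thesis .
  qed
  then have "(\<Sum>x\<in>?X. \<Sum>c\<in>C. pmf (E x) c * ?Y x c) \<le> (\<Sum>x\<in>?X. t + (\<Sum>c\<in>C. exp (?Y x c - t)))"
    by (intro sum_mono)
  also have "\<dots> = ?B * t + (\<Sum>c\<in>C. \<Sum>x\<in>?X. exp (?Y x c)) * exp (- t)"
    using assms(1)
    by (simp add: sum.distrib card_PiE sum.swap[of _ C] sum_distrib_right exp_diff exp_minus divide_inverse)
  also have "\<dots> \<le> ?B * t + (\<Sum>c\<in>C. ?B * exp (2 * real (card I) / real (card V))) * exp (- t)"
    using assms by (intro add_left_mono mult_right_mono sum_mono sum_PiE_exp_le) auto
  also have "\<dots> = ?B * (t + 1)"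
    using cC exp_minus_inverse[of t] by (simp add: t_def exp_add algebra_simps)
  finally show ?thesis
    by (simp add: t_def)
qed

text \<open>A random access code: \<open>R\<close> is shared randomness, \<open>E r x\<close> the encoding of \<open>x\<close>, and
  \<open>F r i c\<close> the attempt to recover the letter \<open>x i\<close> from the code word \<open>c\<close>.\<close>

lemma random_access_code_bound:
  fixes R :: "'r pmf" and E :: "'r \<Rightarrow> ('i \<Rightarrow> 'v) \<Rightarrow> 'c pmf" and F :: "'r \<Rightarrow> 'i \<Rightarrow> 'c \<Rightarrow> 'o pmf"
  assumes fin: "finite I" "finite V" "V \<noteq> {}" "finite C"
    and E: "\<And>r x. r \<in> set_pmf R \<Longrightarrow> x \<in> I \<rightarrow>\<^sub>E V \<Longrightarrow> set_pmf (E r x) \<subseteq> C"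
    and g: "\<And>i. i \<in> I \<Longrightarrow> inj_on (g i) V"
    and p: "\<And>x i. x \<in> I \<rightarrow>\<^sub>E V \<Longrightarrow> i \<in> I \<Longrightarrow>
              p \<le> pmf (bind_pmf R (\<lambda>r. bind_pmf (E r x) (F r i))) (g i (x i))"
  shows "p * real (card I) \<le> ln (real (card C)) + 2 * real (card I) / real (card V) + 1"
proof -
  let ?X = "I \<rightarrow>\<^sub>E V"
  let ?B = "ln (real (card C)) + 2 * real (card I) / real (card V) + 1"
  let ?h = "\<lambda>r x i. pmf (bind_pmf (E r x) (F r i)) (g i (x i))"
  have X: "finite ?X" "?X \<noteq> {}"
    using fin by (auto simp: finite_PiE PiE_eq_empty_iff)
  have cX: "real (card ?X) = real (card V) ^ card I"
    using fin by (simp add: card_PiE)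
  have int: "integrable (measure_pmf R) (\<lambda>r. ?h r x i)" for x i
    by (intro measure_pmf.integrable_const_bound[where B = 1]) (auto simp: pmf_le_1)
  \<comment> \<open>The bound holds for each fixed \<open>r\<close>, so averaging over
    \<open>R\<close> preserves it: shared randomness does not help.\<close>
  have main: "(\<Sum>x\<in>?X. \<Sum>i\<in>I. ?h r x i) \<le> real (card ?X) * ?B" if r: "r \<in> set_pmf R" for r
  proof -
    obtain x where "x \<in> ?X"
      using X by blast
    then have C: "C \<noteq> {}"
      using E[OF r] set_pmf_not_empty[of "E r x"] by blast
    \<comment> \<open>Injectivity of \<open>g i\<close> makes the recovery events of different
      letters disjoint.\<close>
    have D1: "(\<Sum>v\<in>V. pmf (F r i c) (g i v)) \<le> 1" if "i \<in> I" for i c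
    proof -
      have "(\<Sum>v\<in>V. pmf (F r i c) (g i v)) = (\<Sum>a\<in>g i ` V. pmf (F r i c) a)"
        using g[OF that] by (simp add: sum.reindex)
      also have "\<dots> = measure (measure_pmf (F r i c)) (g i ` V)"
        using fin by (simp add: measure_measure_pmf_finite)
      finally show ?thesis
        by simp
    qed
    have "?h r x i = (\<Sum>c\<in>C. pmf (E r x) c * pmf (F r i c) (g i (x i)))" if "x \<in> ?X" for x i
      unfolding pmf_bind
      using E[OF r that] fin(4) by (subst integral_measure_pmf_real[of C]) (auto simp: mult.commute)
    then have "(\<Sum>x\<in>?X. \<Sum>i\<in>I. ?h r x i)
        = (\<Sum>x\<in>?X. \<Sum>c\<in>C. pmf (E r x) c * (\<Sum>i\<in>I. pmf (F r i c) (g i (x i))))"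
      by (simp add: sum.swap[of _ C] sum_distrib_left)
    also have "\<dots> \<le> real (card ?X) * ?B"
      unfolding cX using fin C D1 E[OF r]
      by (intro soft_decoding_bound[where D = "\<lambda>c i v. pmf (F r i c) (g i v)"]) auto
    finally show ?thesis .
  qed
  have "real (card ?X) * (p * real (card I)) = (\<Sum>x\<in>?X. \<Sum>i\<in>I. p)"
    by simp
  also have "\<dots> \<le> (\<Sum>x\<in>?X. \<Sum>i\<in>I. \<integral>r. ?h r x i \<partial>measure_pmf R)"
    using p by (intro sum_mono) (simp add: pmf_bind[of R])
  also have "\<dots> = (\<integral>r. (\<Sum>x\<in>?X. \<Sum>i\<in>I. ?h r x i) \<partial>measure_pmf R)"
    using int by (simp add: Bochner_Integration.integral_sum)
  also have "\<dots> \<le> real (card ?X) * ?B"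
    using main int by (intro measure_pmf.integral_le_const)
      (auto simp: AE_measure_pmf_iff intro!: Bochner_Integration.integrable_sum)
  finally show ?thesis
    using X by (simp add: card_gt_0_iff)
qed

section \<open>Memory contents, runs cut in two, and unconditional output probabilities\<close>

lemma ln_card_short_lists_le:
  "ln (real (card {m :: bool list. length m \<le> s})) \<le> real s + 1"
proof -
  have "card {m :: bool list. length m \<le> s} = (\<Sum>i\<le>s. 2 ^ i)"
    using card_lists_length_le[of "UNIV :: bool set" s] by simp
  also have "\<dots> = 2 ^ Suc s - 1"
    by (simp add: mask_eq_sum_exp_nat[symmetric] lessThan_Suc_atMost[symmetric] lessThan_def)
  finally have c: "card {m :: bool list. length m \<le> s} = 2 ^ Suc s - 1" .
  have "(1::nat) < 2 ^ Suc s"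
    by (rule one_less_power) auto
  then have "0 < card {m :: bool list. length m \<le> s}" "card {m :: bool list. length m \<le> s} \<le> 2 ^ Suc s"
    unfolding c by linarith+
  then have "ln (real (card {m :: bool list. length m \<le> s})) \<le> ln (real (2 ^ Suc s))"
    by (intro ln_mono) (simp_all only: of_nat_le_iff of_nat_0_less_iff)
  also have "\<dots> = ln (2 ^ Suc s)"
    by simp
  also have "\<dots> = real (Suc s) * ln 2"
    by (rule ln_realpow)
  also have "\<dots> \<le> real (Suc s) * 1"
    using ln_le_minus_one[of "2::real"] by (intro mult_left_mono) auto
  finally show ?thesis
    by simp
qed

lemma finite_short_lists: "finite {m :: bool list. length m \<le> s}"
  using finite_lists_length_le[of "UNIV :: bool set" s] by simp

text \<open>Markov property: the rest of a run depends on the past only through the current memory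
  \<open>c\<close>.\<close>

lemma fold_bind_pmf:
  "fold (\<lambda>v D. bind_pmf D (u v)) vs D
     = bind_pmf D (\<lambda>c. fold (\<lambda>v D. bind_pmf D (u v)) vs (return_pmf c))"
proof (induction vs arbitrary: D)
  case Nil
  then show ?case by (simp add: bind_return_pmf')
next
  case (Cons v vs)
  show ?case
    using Cons[of "bind_pmf D (u v)"] Cons[of "u v _"]
    by (simp add: bind_assoc_pmf bind_return_pmf)
qed

text \<open>Exhibits the code: the machine is the shared randomness, the memory after
  \<open>xs\<close> the code word, and processing \<open>ys\<close> and answering the
  decoder.\<close>

lemma result_append:
  "result A U f (xs @ ys) = bind_pmf (A U f) (\<lambda>M.
     bind_pmf (memory_after M (nodes xs)) (\<lambda>c.
       bind_pmf (fold (\<lambda>v D. bind_pmf D (update M v)) (List.enumerate (length xs) ys) (return_pmf c))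
         (answer M)))"
  unfolding result_def memory_after_def nodes_def enumerate_append_eq fold_append o_apply add_0
  by (subst fold_bind_pmf) (simp add: bind_assoc_pmf)

text \<open>Undoes the conditioning, since non-failure has probability at least
  \<open>1 - \<delta>\<close>.\<close>

lemma L_DI_sample_pmf_ge:
  assumes S: "L_DI_sample \<epsilon> \<delta> f \<sigma> D" and i: "i < length \<sigma>"
    and "\<delta> \<le> 1" "\<epsilon> \<le> 1" "0 \<le> degree f \<sigma> i" "0 \<le> DI f \<sigma>"
  shows "(1 - \<delta>) * ((1 - \<epsilon>) * (1 / degree f \<sigma> i / DI f \<sigma>)) \<le> pmf D (Some (i, \<sigma> ! i))"
proof -
  let ?q = "1 / degree f \<sigma> i / DI f \<sigma>"
  let ?S = "measure (measure_pmf D) {r. r \<noteq> None}"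
  have "measure (measure_pmf D) {r. r = None} \<le> \<delta>"
    using S by (simp add: L_DI_sample_def)
  moreover have "?S = 1 - measure (measure_pmf D) {r. r = None}"
    using measure_pmf.prob_compl[of "{r. r = None}" D] unfolding Collect_neg_eq by (simp add: Compl_eq_Diff_UNIV)
  ultimately have S1: "1 - \<delta> \<le> ?S"
    by linarith
  have "{r. r = Some (i, \<sigma> ! i) \<and> r \<noteq> None} = {Some (i, \<sigma> ! i)}"
    by auto
  then have q: "(1 - \<epsilon>) * ?q \<le> pmf D (Some (i, \<sigma> ! i)) / ?S"
    using S i by (auto simp: L_DI_sample_def Let_def cond_prob_def pmf.rep_eq)
  have "(1 - \<delta>) * ((1 - \<epsilon>) * ?q) \<le> ?S * ((1 - \<epsilon>) * ?q)"
    using S1 assms by (intro mult_right_mono) auto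
  also have "\<dots> \<le> ?S * (pmf D (Some (i, \<sigma> ! i)) / ?S)"
    using q by (intro mult_left_mono) auto
  \<comment> \<open>If \<open>?S = 0\<close>, the quotient is 0 by convention and the inequality
    still holds.\<close>
  also have "\<dots> \<le> pmf D (Some (i, \<sigma> ! i))"
    by simp
  finally show ?thesis .
qed


section \<open>The hard streams and their degrees\<close>

text \<open>The item \<open>(i, v)\<close> with \<open>v < K\<close> stands for the letter \<open>v\<close> at position \<open>i\<close>, and \<open>(j, K)\<close> is the
  item that marks position \<open>j\<close>.\<close>

definition gadget_sim :: "nat \<Rightarrow> nat \<times> nat \<Rightarrow> nat \<times> nat \<Rightarrow> real" where
  "gadget_sim K a b =
     (if a = b \<or> fst a \<noteq> fst b \<and> (snd a = K) \<noteq> (snd b = K) then 1 else 0)"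

definition gadget_stream :: "nat \<Rightarrow> nat \<Rightarrow> nat \<Rightarrow> (nat \<Rightarrow> nat) \<Rightarrow> nat \<Rightarrow> (nat \<times> nat) list" where
  "gadget_stream K m n x j = map (\<lambda>i. (i, x i)) [0..<m] @ replicate (n - m) (j, K)"

lemma length_gadget_stream [simp]: "m \<le> n \<Longrightarrow> length (gadget_stream K m n x j) = n"
  by (simp add: gadget_stream_def)

lemma nth_gadget_stream:
  "i < n \<Longrightarrow> gadget_stream K m n x j ! i = (if i < m then (i, x i) else (j, K))"
  by (simp add: gadget_stream_def nth_append)

lemma set_gadget_stream_subset:
  "x \<in> {..<m} \<rightarrow>\<^sub>E {..<K} \<Longrightarrow> j < m \<Longrightarrow> set (gadget_stream K m n x j) \<subseteq> {..<m} \<times> {..K}"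
  by (auto simp: gadget_stream_def PiE_iff less_imp_le)

text \<open>Letters are pairwise dissimilar, and \<open>(j, K)\<close> shares its first component
  with \<open>(j, x j)\<close>; only the self-loop remains.\<close>

lemma degree_gadget_marked:
  assumes "x \<in> {..<m} \<rightarrow>\<^sub>E {..<K}" "j < m" "m \<le> n"
  shows "degree (gadget_sim K) (gadget_stream K m n x j) j = 1"
proof -
  have "x j < K"
    using assms by (auto simp: PiE_iff)
  have "x i < K" if "i < m" for i
    using assms that by (auto simp: PiE_iff)
  then have "degree (gadget_sim K) (gadget_stream K m n x j) j = (\<Sum>i<n. if i = j then 1 else 0)"
    unfolding degree_def length_gadget_stream[OF assms(3)] using assms(2,3) \<open>x j < K\<close>
    by (intro sum.cong) (auto simp: nth_gadget_stream gadget_sim_def)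
  then show ?thesis
    using assms by simp
qed

text \<open>The copies of the marker suffice: they equal each other, and every letter away from
  \<open>j\<close> is similar to them.\<close>

lemma degree_gadget_unmarked:
  assumes "x \<in> {..<m} \<rightarrow>\<^sub>E {..<K}" "m \<le> n" "i < n" "i \<noteq> j"
  shows "real (n - m) \<le> degree (gadget_sim K) (gadget_stream K m n x j) i"
proof -
  have "x i < K" if "i < m"
    using assms that by (auto simp: PiE_iff)
  then have "real (n - m) = (\<Sum>l\<in>{m..<n}. gadget_sim K (gadget_stream K m n x j ! i) (gadget_stream K m n x j ! l))"
    using assms by (subst sum.cong[OF refl, of _ _ "\<lambda>_. 1"]) (auto simp: nth_gadget_stream gadget_sim_def)
  also have "\<dots> \<le> degree (gadget_sim K) (gadget_stream K m n x j) i"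
    unfolding degree_def length_gadget_stream[OF assms(2)]
    by (intro sum_mono2) (auto simp: gadget_sim_def)
  finally show ?thesis .
qed

lemma DI_gadget:
  assumes "x \<in> {..<m} \<rightarrow>\<^sub>E {..<K}" "j < m" "2 * m \<le> n"
  shows "0 < DI (gadget_sim K) (gadget_stream K m n x j)"
    and "DI (gadget_sim K) (gadget_stream K m n x j) \<le> 3"
proof -
  let ?d = "degree (gadget_sim K) (gadget_stream K m n x j)"
  have mn: "m \<le> n" "m < n" "j < n"
    using assms by auto
  have "DI (gadget_sim K) (gadget_stream K m n x j) = (\<Sum>i<n. 1 / ?d i)"
    using mn by (simp add: DI_def)
  also have "\<dots> = 1 / ?d j + (\<Sum>i\<in>{..<n} - {j}. 1 / ?d i)"
    using mn by (intro sum.remove) auto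
  finally have eq: "DI (gadget_sim K) (gadget_stream K m n x j) = 1 + (\<Sum>i\<in>{..<n} - {j}. 1 / ?d i)"
    using degree_gadget_marked[OF assms(1,2) mn(1)] by simp
  have d: "real (n - m) \<le> ?d i" if "i \<in> {..<n} - {j}" for i
    using degree_gadget_unmarked[OF assms(1) mn(1)] that by auto
  have "0 \<le> (\<Sum>i\<in>{..<n} - {j}. 1 / ?d i)"
    using d by (intro sum_nonneg divide_nonneg_nonneg) (auto intro: order_trans[OF of_nat_0_le_iff])
  then show "0 < DI (gadget_sim K) (gadget_stream K m n x j)"
    unfolding eq by linarith
  have "(\<Sum>i\<in>{..<n} - {j}. 1 / ?d i) \<le> (\<Sum>i\<in>{..<n} - {j}. 1 / real (n - m))"
    using d mn by (intro sum_mono frac_le) auto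
  also have "\<dots> = real (n - 1) / real (n - m)"
    using mn by simp
  \<comment> \<open>By \<open>2 * m \<le> n\<close> the suffix fills at least half of the
    stream.\<close>
  also have "\<dots> \<le> 2"
    using assms mn by (simp add: field_simps of_nat_diff)
  finally show "DI (gadget_sim K) (gadget_stream K m n x j) \<le> 3"
    unfolding eq by linarith
qed

section \<open>Transport to an arbitrary infinite item type, and the reduction\<close>

lemma degree_map:
  assumes "\<And>a. a \<in> set \<sigma> \<Longrightarrow> d (e a) = a" "i < length \<sigma>"
  shows "degree (\<lambda>a b. g (d a) (d b)) (map e \<sigma>) i = degree g \<sigma> i"
  using assms by (simp add: degree_def)

lemma DI_map:
  assumes "\<And>a. a \<in> set \<sigma> \<Longrightarrow> d (e a) = a"
  shows "DI (\<lambda>a b. g (d a) (d b)) (map e \<sigma>) = DI g \<sigma>"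
  using assms by (simp add: DI_def degree_map)

text \<open>\<open>m * Suc K\<close> counts the gadget items. The 2 is one unit from counting memory
  contents and one from the code bound.\<close>

lemma sampler_space_bound:
  fixes A :: "'u::infinite algorithm"
  assumes A: "one_pass_L_DI_sampler n \<epsilon> \<delta> A" "space_at_most n k A s"
    and "\<epsilon> \<le> 1" "\<delta> \<le> 1" "0 < K" "0 < m" "2 * m \<le> n" "m * Suc K \<le> k"
  shows "(1 - \<delta>) * (1 - \<epsilon>) / 3 * real m \<le> real s + 2 + 2 * real m / real K"
proof -
  let ?S = "{..<m} \<times> {..K}"
  let ?X = "{..<m} \<rightarrow>\<^sub>E {..<K}"
  obtain e :: "nat \<times> nat \<Rightarrow> 'u" where e: "inj_on e ?S"
    using arb_inj_on_finite_infinite[of ?S] by auto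
  define d where "d = inv_into ?S e"
  define U where "U = e ` ?S"
  \<comment> \<open>\<open>U\<close> and \<open>f\<close> depend on neither the word nor
    \<open>j\<close>, so \<open>A U f\<close> can serve as the shared randomness.\<close>
  define f where "f = (\<lambda>a b. gadget_sim K (d a) (d b))"
  define pre where "pre x = map e (map (\<lambda>i. (i, x i)) [0..<m])" for x
  define suf where "suf j = map e (replicate (n - m) (j, K))" for j
  define E where "E M x = memory_after M (nodes (pre x))" for M :: "'u machine" and x
  define F where "F M j c = bind_pmf (fold (\<lambda>v D. bind_pmf D (update M v))
      (List.enumerate m (suf j)) (return_pmf c)) (answer M)" for M :: "'u machine" and j c
  have mn: "m \<le> n"
    using assms by simp
  have de: "d (e a) = a" if "a \<in> ?S" for a
    using e that by (simp add: d_def)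
  have U: "finite U" "card U \<le> k"
    using assms(8) card_image_le[of ?S e] by (auto simp: U_def)
  have sim: "similarity U f"
    by (auto simp: similarity_def f_def gadget_sim_def)
  have split: "map e (gadget_stream K m n x j) = pre x @ suf j" for x j
    by (simp add: gadget_stream_def pre_def suf_def)
  have stream: "set (pre x @ suf j) \<subseteq> U" "length (pre x @ suf j) = n"
    if "x \<in> ?X" "j < m" for x j
    using set_gadget_stream_subset[OF that, of n] mn
    by (auto simp: U_def simp flip: split)
  have "(1 - \<delta>) * (1 - \<epsilon>) / 3 * real (card {..<m})
      \<le> ln (real (card {c :: memory. length c \<le> s}))
          + 2 * real (card {..<m}) / real (card {..<K}) + 1"
  proof (rule random_access_code_bound[where R = "A U f" and E = E and F = F
        and g = "\<lambda>j v. Some (j, e (j, v))"])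
    show "{..<K} \<noteq> {}"
      using \<open>0 < K\<close> by auto
    show "finite {c :: memory. length c \<le> s}"
      by (rule finite_short_lists)
    show "inj_on (\<lambda>v. Some (j, e (j, v))) {..<K}" if "j \<in> {..<m}" for j
      using that inj_onD[OF e] by (fastforce intro!: inj_onI)
    show "set_pmf (E M x) \<subseteq> {c. length c \<le> s}" if M: "M \<in> set_pmf (A U f)" and x: "x \<in> ?X" for M x
    proof -
      \<comment> \<open>The space bound speaks of prefixes of streams of length \<open>n\<close>, so
        some suffix must be supplied; position 0 is legal by \<open>0 < m\<close>.\<close>
      have "nodes (pre x) = take m (nodes (pre x @ suf 0))"
        by (simp add: nodes_def enumerate_append_eq pre_def)
      with A(2) U sim stream[OF x, of 0] M mn \<open>0 < m\<close> show ?thesis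
        unfolding space_at_most_def E_def by (metis (no_types, lifting) mem_Collect_eq subsetI)
    qed
    show "(1 - \<delta>) * (1 - \<epsilon>) / 3
        \<le> pmf (bind_pmf (A U f) (\<lambda>M. bind_pmf (E M x) (F M j))) (Some (j, e (j, x j)))"
      if x: "x \<in> ?X" and j: "j \<in> {..<m}" for x j
    proof -
      let ?\<sigma> = "gadget_stream K m n x j"
      have j: "j < m" "j < n"
        using j mn by auto
      have inv: "d (e a) = a" if "a \<in> set ?\<sigma>" for a
        using set_gadget_stream_subset[OF x j(1)] that by (intro de) auto
      have deg: "degree f (map e ?\<sigma>) j = 1"
        unfolding f_def using inv j mn degree_gadget_marked[OF x j(1) mn] by (subst degree_map) auto
      have DI: "DI f (map e ?\<sigma>) = DI (gadget_sim K) ?\<sigma>"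
        unfolding f_def using inv by (intro DI_map)
      note DI_bounds = DI_gadget[OF x j(1) assms(7), folded DI]
      have res: "result A U f (map e ?\<sigma>) = bind_pmf (A U f) (\<lambda>M. bind_pmf (E M x) (F M j))"
        unfolding split result_append by (simp add: E_def F_def[abs_def] pre_def)
      have "L_DI_sample \<epsilon> \<delta> f (map e ?\<sigma>) (result A U f (map e ?\<sigma>))"
        using A(1) U sim stream[OF x j(1)] unfolding one_pass_L_DI_sampler_def split by blast
      from L_DI_sample_pmf_ge[OF this, of j] assms(3,4) j mn DI_bounds deg
      have "(1 - \<delta>) * ((1 - \<epsilon>) * (1 / DI f (map e ?\<sigma>)))
          \<le> pmf (result A U f (map e ?\<sigma>)) (Some (j, e (j, x j)))"
        by (simp add: nth_gadget_stream)
      moreover have "(1 - \<delta>) * ((1 - \<epsilon>) * (1 / 3)) \<le> (1 - \<delta>) * ((1 - \<epsilon>) * (1 / DI f (map e ?\<sigma>)))"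
        using assms(3,4) DI_bounds by (intro mult_left_mono divide_left_mono) auto
      ultimately show ?thesis
        unfolding res times_divide_eq_right mult_1_right mult.assoc by linarith
    qed
  qed auto
  then show ?thesis
    using ln_card_short_lists_le[of s] by simp
qed

theorem theorem18:
  shows "\<exists>c::real. c > 0 \<and>
    (\<forall>\<^sub>F n in sequentially.
       \<forall>\<epsilon>\<in>{0<..<0.9}. \<forall>(A :: 'u::infinite algorithm) (s::nat).
         one_pass_L_DI_sampler n \<epsilon> 0.49 A \<longrightarrow> space_at_most n n A s \<longrightarrow>
           c * real n \<le> real s)"
proof (intro exI conjI)
  \<comment> \<open>Any constant below 0.009 / 251 would do for large \<open>n\<close>; this one
    leaves room for the additive terms once \<open>n\<close> reaches 100000.\<close>
  show "(0::real) < 1 / 100000"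
    by simp
  have "1 / 100000 * real n \<le> real s"
    if n: "100000 \<le> n" and \<epsilon>: "\<epsilon> \<in> {0<..<0.9}"
      and A: "one_pass_L_DI_sampler n \<epsilon> 0.49 A" "space_at_most n n A s"
    for n s \<epsilon> and A :: "'u algorithm"
  proof -
    \<comment> \<open>\<open>K = 250\<close> makes the guessing term 2 / 250 = 0.008 smaller than
      the recovery rate 0.51 * 0.1 / 3 = 0.017. Each position then uses 251 items, and the universe
      may have at most \<open>n\<close>.\<close>
    define m where "m = n div 251"
    have "m * 251 + n mod 251 = n" "n mod 251 < 251"
      by (simp_all add: m_def)
    then have m: "2 * m \<le> n" "m * Suc 250 \<le> n" "n \<le> 251 * m + 250"
      by simp_all
    have "0 < m"
      using n by (simp add: m_def div_greater_zero_iff)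
    have "(1 - 0.49) * (1 - 0.9) / 3 * real m \<le> (1 - 0.49) * (1 - \<epsilon>) / 3 * real m"
      using \<epsilon> by (intro mult_right_mono divide_right_mono mult_left_mono) auto
    also have "\<dots> \<le> real s + 2 + 2 * real m / real 250"
      using \<epsilon> m \<open>0 < m\<close> by (intro sampler_space_bound[OF A]) auto
    finally have "0.009 * real m \<le> real s + 2"
      by simp
    with of_nat_mono[OF m(3), where 'a = real] n show ?thesis
      by simp
  qed
  then show "\<forall>\<^sub>F n in sequentially. \<forall>\<epsilon>\<in>{0<..<0.9}. \<forall>(A :: 'u algorithm) (s::nat).
      one_pass_L_DI_sampler n \<epsilon> 0.49 A \<longrightarrow> space_at_most n n A s \<longrightarrow> 1 / 100000 * real n \<le> real s"
    by (intro eventually_sequentiallyI[of 100000]) blast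
qed

end
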